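(* Let an Adinkra with $N$ colors and vertex set $V$ be given, with boson–fermion matrix $X$ and signed Laplacian $L$. Then: (a) the first invariant factor of $X$ is $1$, and the last invariant factor of $X$ is $N$; (b) the first two invariant factors of $L$ are $1$, and the last two invariant factors of $L$ are $N(N-1)$.
   Context: A signed graph is a finite undirected simple graph $(V,E)$ with a signature $\mu:E\to\{-1,1\}$; edges with $\mu(e)=-1$ are called dashed, those with $\mu(e)=1$ solid. An Adinkra with $N\ge 1$ colors is a non-empty finite bipartite signed graph $(V,E,\mu)$ (with a fixed bipartition of $V$ into bosons and fermions, every edge joining a boson to a fermion), together with an assignment of one of $N$ colors to each edge and a function $h:V\to\mathbb{Z}$ (the function $h$ plays no role here), such that: (i) each vertex is incident to exactly $N$ edges, one of each color; (ii) for any two distinct colors, the subgraph consisting of all edges of those two colors is a disjoint union of $4$-cycles (called bicolor cycles); (iii) every bicolor cycle contains an odd number of dashed edges; (iv) $|h(v)-h(w)|=1$ for adjacent $v,w$. An Adinkra need not be connected; there are $\#V/2$ bosons and $\#V/2$ fermions. $X$ is the $\frac{\#V}{2}\times\frac{\#V}{2}$ integer matrix whose $(i,j)$ entry is $\mu(e)$ if there is an edge $e$ between the $i$th boson and $j$th fermion, and $0$ otherwise. With bosons ordered first, the signed Laplacian is $L=\begin{pmatrix}NI&-X\\-X^T&NI\end{pmatrix}$. The invariant factors of an integer square matrix are the nonnegative diagonal entries $d_1\mid d_2\mid\cdots$ of its Smith Normal Form over $\mathbb{Z}$, listed in this order with multiplicity (entries may be $0$).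
   Formalization: Part (b) is stated only for #V > 2; this excludes just the one-color Adinkra consisting of a single edge, where L is 2×2 with invariant factors 1, 0, so that (b) is false there. *)

theory Defs
  imports "Jordan_Normal_Form.Matrix"
begin

section \<open>Adinkras\<close>

text \<open>Edges of simple graphs are two-element sets of vertices.\<close>

locale signed_graph =
  fixes V :: "'v set" and E :: "'v set set" and \<mu> :: "'v set \<Rightarrow> int"
  assumes finite_V: "finite V"
    and edges: "e \<in> E \<Longrightarrow> e \<subseteq> V \<and> card e = 2"
    and signature: "e \<in> E \<Longrightarrow> \<mu> e \<in> {-1, 1}"

definition four_cycle :: "'v set set \<Rightarrow> bool" where
  "four_cycle Q \<longleftrightarrow>
    (\<exists>a b c d. distinct [a, b, c, d] \<and> Q = {{a, b}, {b, c}, {c, d}, {d, a}})"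

definition disjoint_union_of_four_cycles :: "'v set set \<Rightarrow> bool" where
  "disjoint_union_of_four_cycles S \<longleftrightarrow>
    (\<exists>\<Q>. (\<forall>Q\<in>\<Q>. four_cycle Q) \<and> pairwise (\<lambda>Q R. disjnt (\<Union>Q) (\<Union>R)) \<Q> \<and> \<Union>\<Q> = S)"

definition bicolor_edges :: "'v set set \<Rightarrow> ('v set \<Rightarrow> nat) \<Rightarrow> nat \<Rightarrow> nat \<Rightarrow> 'v set set" where
  "bicolor_edges E color i j = {e \<in> E. color e = i \<or> color e = j}"

text \<open>
  The colors are \<open>0, \<dots>, N - 1\<close>; \<open>bosons\<close> and \<open>fermions\<close> are the two classes of the fixed
  bipartition. In \<open>bicolor_four_cycles\<close> the two-color subgraph is represented by its edge set; it
  has no isolated vertices because of \<open>one_edge_of_each_color\<close>. The bicolor cycles are its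
  components, which are exactly the 4-cycles contained in it, since it is 2-regular.
\<close>

locale adinkra = signed_graph V E \<mu>
  for V :: "'v set" and E :: "'v set set" and \<mu> :: "'v set \<Rightarrow> int" +
  fixes bosons fermions :: "'v set"
    and N :: nat
    and color :: "'v set \<Rightarrow> nat"
    and h :: "'v \<Rightarrow> int"
  assumes N_pos: "1 \<le> N"
    and V_nonempty: "V \<noteq> {}"
    and bipartition: "bosons \<union> fermions = V" "bosons \<inter> fermions = {}"
    and bipartite: "e \<in> E \<Longrightarrow> \<exists>b\<in>bosons. \<exists>f\<in>fermions. e = {b, f}"
    and one_edge_of_each_color: "v \<in> V \<Longrightarrow> bij_betw color {e \<in> E. v \<in> e} {..<N}"
    and bicolor_four_cycles:
      "\<lbrakk>i < N; j < N; i \<noteq> j\<rbrakk> \<Longrightarrow> disjoint_union_of_four_cycles (bicolor_edges E color i j)"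
    and odd_dashed:
      "\<lbrakk>i < N; j < N; i \<noteq> j; four_cycle Q; Q \<subseteq> bicolor_edges E color i j\<rbrakk>
        \<Longrightarrow> odd (card {e \<in> Q. \<mu> e = -1})"
    and heights: "{v, w} \<in> E \<Longrightarrow> \<bar>h v - h w\<bar> = 1"


section \<open>The boson-fermion matrix and the signed Laplacian\<close>

text \<open>
  The lists \<open>bs\<close> and \<open>fs\<close> enumerate the bosons and the fermions. For \<open>N = 1\<close> and a single edge
  the signed Laplacian has order 2 and invariant factors 1, 0, so a claim that its first two
  invariant factors are 1 has to exclude this Adinkra.
\<close>

definition boson_fermion_matrix ::
  "'v set set \<Rightarrow> ('v set \<Rightarrow> int) \<Rightarrow> 'v list \<Rightarrow> 'v list \<Rightarrow> int mat" where
  "boson_fermion_matrix E \<mu> bs fs =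
    mat (length bs) (length fs) (\<lambda>(i, j). if {bs ! i, fs ! j} \<in> E then \<mu> {bs ! i, fs ! j} else 0)"

definition signed_laplacian :: "nat \<Rightarrow> int mat \<Rightarrow> int mat" where
  "signed_laplacian N X =
    four_block_mat (int N \<cdot>\<^sub>m 1\<^sub>m (dim_row X)) (- X)
                   (- transpose_mat X)          (int N \<cdot>\<^sub>m 1\<^sub>m (dim_col X))"


section \<open>Invariant factors\<close>

definition smith_normal_form :: "int mat \<Rightarrow> int mat \<Rightarrow> bool" where
  "smith_normal_form A D \<longleftrightarrow>
    (\<exists>P \<in> carrier_mat (dim_row A) (dim_row A). \<exists>Q \<in> carrier_mat (dim_col A) (dim_col A).
       invertible_mat P \<and> invertible_mat Q \<and> D = P * A * Q) \<and>
    diagonal_mat D \<and>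
    (\<forall>i < dim_row D. 0 \<le> D $$ (i, i)) \<and>
    (\<forall>i. Suc i < dim_row D \<longrightarrow> D $$ (i, i) dvd D $$ (Suc i, Suc i))"

text \<open>
  Only meaningful for square matrices. Every square integer matrix has exactly one Smith normal
  form, so the choice is immaterial.
\<close>

definition invariant_factors :: "int mat \<Rightarrow> int list" where
  "invariant_factors A = diag_mat (SOME D. smith_normal_form A D)"

end

theory Submission
  imports Defs "Jordan_Normal_Form.Column_Operations"
begin

text \<open>
  Let \<open>S\<close> be the signed adjacency matrix on all vertices. For two vertices \<open>a \<noteq> b\<close>, each common
  neighbor \<open>f\<close> determines a bicolor cycle through \<open>a - f - b\<close>, and the fourth vertex of that cycle is
  a common neighbor with the opposite sign, since the number of dashed edges is odd. So the rows of
  \<open>S\<close> are orthogonal and \<open>S\<^sup>2 = N I\<close> (\<open>signed_adjacency_gram\<close>). Consequently \<open>X X\<^sup>T = N I\<close>, and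
  \<open>L = N I - S\<close> satisfies \<open>L (N I + S) = N (N - 1) I\<close>.

  Such an equation \<open>A B = c I\<close> ties the last invariant factors of \<open>A\<close> to the first ones of \<open>B\<close>: if
  \<open>D = P A Q\<close> is the Smith normal form, then the matrix \<open>Y\<close> equivalent to \<open>B\<close> with \<open>D Y = c I\<close> is diagonal
  with entries \<open>c / d\<^sub>i\<close>, at least where \<open>d\<^sub>i \<noteq> 0\<close> (\<open>smith_form_complement\<close>). The first invariant factor
  of a matrix divides all its entries, and the second one all its two-rowed minors. The matrix \<open>X\<close> has an
  entry \<open>\<plusminus>1\<close>, and \<open>N I \<plusminus> S\<close> has the coprime minors \<open>N\<^sup>2 - 1\<close> and \<open>\<plusminus>N\<close>
  (\<open>primitive_minors2_shifted_adjacency\<close>) once there is a third vertex. So the first factors of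
  \<open>X\<close> and \<open>X\<^sup>T\<close>, and the first two of \<open>L\<close> and \<open>N I + S\<close>, are 1; the last ones are their complements
  in \<open>c\<close>. The argument includes \<open>N = 1\<close>, where \<open>c = 0\<close> for the Laplacian.

  The invariant factors are read off from a chosen Smith normal form, so it must be known that one
  exists (\<open>smith_form_exists\<close>). This is shown by induction on the order: a smallest nonzero corner entry among all
  equivalent matrices divides everything else (\<open>orbit_pivot\<close>) and can be split off.
\<close>

section \<open>Existence of the Smith normal form\<close>

text \<open>
  The unimodular matrices, taken as the units of the matrix ring so that products and elementary
  matrices are covered by the general theory of units.
\<close>

abbreviation GL :: "nat \<Rightarrow> int mat set" where
  "GL n \<equiv> Units (ring_mat TYPE(int) n ())"

lemma GL_intro:
  assumes "P \<in> carrier_mat n n" "P' \<in> carrier_mat n n" "P * P' = 1\<^sub>m n" "P' * P = 1\<^sub>m n"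
  shows "P \<in> GL n"
  using assms by (auto simp: Units_def ring_mat_def)

lemma GL_carrier: "P \<in> GL n \<Longrightarrow> P \<in> carrier_mat n n"
  by (auto simp: Units_def ring_mat_def)

lemma GL_inverse:
  assumes "P \<in> GL n"
  obtains P' where "P' \<in> GL n" "P * P' = 1\<^sub>m n" "P' * P = 1\<^sub>m n"
proof -
  from assms obtain P' where "P' \<in> carrier_mat n n" "P * P' = 1\<^sub>m n" "P' * P = 1\<^sub>m n"
    by (auto simp: Units_def ring_mat_def)
  with GL_intro[of P' n P] GL_carrier[OF assms] that show thesis by blast
qed

lemma GL_one: "1\<^sub>m n \<in> GL n"
  by (rule GL_intro[of _ _ "1\<^sub>m n"]) auto

lemma GL_mult:
  assumes "P \<in> GL n" "Q \<in> GL n"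
  shows "P * Q \<in> GL n"
proof -
  interpret ring "ring_mat TYPE(int) n ()" by (rule ring_mat)
  show ?thesis using Units_m_closed[OF assms] by (simp add: ring_mat_def)
qed

lemma GL_iff_invertible: "P \<in> GL n \<longleftrightarrow> P \<in> carrier_mat n n \<and> invertible_mat P"
proof
  assume P: "P \<in> GL n"
  then obtain P' where "P' \<in> GL n" "P * P' = 1\<^sub>m n" "P' * P = 1\<^sub>m n" by (rule GL_inverse)
  with P show "P \<in> carrier_mat n n \<and> invertible_mat P"
    using GL_carrier[of P n] GL_carrier[of P' n]
    by (auto simp: invertible_mat_def inverts_mat_def)
next
  assume P: "P \<in> carrier_mat n n \<and> invertible_mat P"
  then obtain P' where 1: "P * P' = 1\<^sub>m n" "P' * P = 1\<^sub>m (dim_row P')"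
    by (auto simp: invertible_mat_def inverts_mat_def)
  have "dim_col P' = n" using arg_cong[OF 1(1), of dim_col] by simp
  moreover have "dim_row P' = n" using arg_cong[OF 1(2), of dim_col] P by auto
  ultimately have "P' \<in> carrier_mat n n" by auto
  with P 1 show "P \<in> GL n" by (intro GL_intro[of P n P']) auto
qed

lemma dvd_mult_entries:
  fixes A P Q :: "int mat"
  assumes "A \<in> carrier_mat n n" "P \<in> carrier_mat n n" "Q \<in> carrier_mat n n"
    and "\<And>i j. i < n \<Longrightarrow> j < n \<Longrightarrow> a dvd A $$ (i, j)"
    and "i < n" "j < n"
  shows "a dvd (P * A * Q) $$ (i, j)"
proof -
  have "a dvd (A * Q) $$ (k, l)" if "k < n" "l < n" for k l
    using assms that by (auto simp: scalar_prod_def intro!: dvd_sum)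
  then have "a dvd (P * (A * Q)) $$ (i, j)"
    using assms by (auto simp: scalar_prod_def intro!: dvd_sum)
  then show ?thesis using assms by simp
qed

text \<open>
  The shape of a Smith normal form is kept apart from its equivalence to a given matrix, so that
  the induction can treat the lower right block on its own.
\<close>

definition smith_form :: "nat \<Rightarrow> int mat \<Rightarrow> bool" where
  "smith_form n D \<longleftrightarrow> D \<in> carrier_mat n n \<and> diagonal_mat D \<and> (\<forall>i<n. 0 \<le> D $$ (i, i)) \<and>
     (\<forall>i. Suc i < n \<longrightarrow> D $$ (i, i) dvd D $$ (Suc i, Suc i))"

definition unimodular_orbit :: "nat \<Rightarrow> int mat \<Rightarrow> int mat set" where
  "unimodular_orbit n A = {P * A * Q |P Q. P \<in> GL n \<and> Q \<in> GL n}"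

lemma orbit_carrier: "A \<in> carrier_mat n n \<Longrightarrow> B \<in> unimodular_orbit n A \<Longrightarrow> B \<in> carrier_mat n n"
  by (auto simp: unimodular_orbit_def dest!: GL_carrier)

lemma orbit_self: "A \<in> carrier_mat n n \<Longrightarrow> A \<in> unimodular_orbit n A"
  using GL_one[of n] by (auto simp: unimodular_orbit_def intro!: exI[of _ "1\<^sub>m n"])

lemma orbit_trans:
  assumes A: "A \<in> carrier_mat n n" and "B \<in> unimodular_orbit n A" "P \<in> GL n" "Q \<in> GL n"
  shows "P * B * Q \<in> unimodular_orbit n A"
proof -
  obtain P1 Q1 where B: "B = P1 * A * Q1" and PQ: "P1 \<in> GL n" "Q1 \<in> GL n"
    using assms(2) by (auto simp: unimodular_orbit_def)
  note c = GL_carrier[OF PQ(1)] GL_carrier[OF PQ(2)] GL_carrier[OF assms(3)] GL_carrier[OF assms(4)] A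
  have "P * B * Q = (P * P1) * A * (Q1 * Q)"
    unfolding B using c by (simp add: assoc_mult_mat[of _ n n _ n _ n])
  then show ?thesis using PQ assms(3,4) GL_mult unfolding unimodular_orbit_def by blast
qed

lemma orbit_left:
  assumes "A \<in> carrier_mat n n" "B \<in> unimodular_orbit n A" "P \<in> GL n"
  shows "P * B \<in> unimodular_orbit n A"
  using orbit_trans[OF assms GL_one] GL_carrier[OF assms(3)] orbit_carrier[OF assms(1,2)] by simp

lemma orbit_right:
  assumes "A \<in> carrier_mat n n" "B \<in> unimodular_orbit n A" "Q \<in> GL n"
  shows "B * Q \<in> unimodular_orbit n A"
  using orbit_trans[OF assms(1,2) GL_one assms(3)] GL_carrier[OF assms(3)] orbit_carrier[OF assms(1,2)]
  by simp

lemma orbit_elementary: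
  assumes A: "A \<in> carrier_mat n n" and B: "B \<in> unimodular_orbit n A" and kl: "k < n" "l < n"
  shows "swaprows k l B \<in> unimodular_orbit n A" "swapcols k l B \<in> unimodular_orbit n A"
    "k \<noteq> l \<Longrightarrow> addrow a k l B \<in> unimodular_orbit n A" "k \<noteq> l \<Longrightarrow> addcol a k l B \<in> unimodular_orbit n A"
proof -
  note Bc = orbit_carrier[OF A B]
  have sw: "swaprows_mat n k l \<in> GL n" by (rule swaprows_mat_Unit[OF kl])
  show "swaprows k l B \<in> unimodular_orbit n A"
    using orbit_left[OF A B sw] swaprows_mat[OF Bc kl] by simp
  show "swapcols k l B \<in> unimodular_orbit n A"
    using orbit_right[OF A B sw] swapcols_mat[OF Bc kl] by simp
  show "addrow a k l B \<in> unimodular_orbit n A" if "k \<noteq> l"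
    using orbit_left[OF A B addrow_mat_Unit[OF kl that]] addrow_mat[OF Bc kl(2)] by simp
  show "addcol a k l B \<in> unimodular_orbit n A" if "k \<noteq> l"
    using orbit_right[OF A B addrow_mat_Unit[OF kl(2,1) that[symmetric]]]
      addcol_mat[OF Bc kl(2)] by simp
qed

lemma GL_four_block_lower:
  assumes C: "C \<in> carrier_mat n 1"
  shows "four_block_mat (1\<^sub>m 1) (0\<^sub>m 1 n) C (1\<^sub>m n) \<in> GL (Suc n)"
proof -
  let ?L = "\<lambda>C. four_block_mat (1\<^sub>m 1) (0\<^sub>m 1 n) C (1\<^sub>m n) :: int mat"
  have one: "?L X * ?L Y = 1\<^sub>m (Suc n)" if "X \<in> carrier_mat n 1" "Y \<in> carrier_mat n 1" "X + Y = 0\<^sub>m n 1"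
    for X Y
  proof -
    have "?L X * ?L Y = four_block_mat (1\<^sub>m 1) (0\<^sub>m 1 n) (X + Y) (1\<^sub>m n)"
      using that(1,2) by (subst mult_four_block_mat[of _ 1 1 _ n _ n _ _ 1 _ n]) auto
    also have "\<dots> = 1\<^sub>m (1 + n)" using that(3) by simp
    finally show ?thesis by simp
  qed
  have "C + - C = 0\<^sub>m n 1" "- C + C = 0\<^sub>m n 1" using C by auto
  then show ?thesis using C one[of C "- C"] one[of "- C" C]
    by (intro GL_intro[of _ _ "?L (- C)"]) auto
qed

lemma GL_transpose:
  assumes "P \<in> GL n" shows "transpose_mat P \<in> GL n"
proof -
  obtain P' where P': "P' \<in> GL n" "P * P' = 1\<^sub>m n" "P' * P = 1\<^sub>m n" using assms by (rule GL_inverse)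
  note c = GL_carrier[OF assms] GL_carrier[OF P'(1)]
  show ?thesis
    using c transpose_mult[OF c, symmetric] transpose_mult[OF c(2,1), symmetric]
    by (intro GL_intro[of _ _ "transpose_mat P'"]) (auto simp: P'(2,3))
qed

lemma GL_block_diag:
  assumes P: "P \<in> GL n" and s: "s * s = 1"
  shows "four_block_mat (mat 1 1 (\<lambda>_. s)) (0\<^sub>m 1 n) (0\<^sub>m n 1) P \<in> GL (Suc n)"
proof -
  obtain P' where P': "P' \<in> GL n" "P * P' = 1\<^sub>m n" "P' * P = 1\<^sub>m n" using P by (rule GL_inverse)
  note c = GL_carrier[OF P] GL_carrier[OF P'(1)]
  have ss: "mat 1 1 (\<lambda>_. s) * mat 1 1 (\<lambda>_. s) = 1\<^sub>m 1"
    using s by (intro eq_matI) (auto simp: scalar_prod_def)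
  have one: "four_block_mat (mat 1 1 (\<lambda>_. s)) (0\<^sub>m 1 n) (0\<^sub>m n 1) X
      * four_block_mat (mat 1 1 (\<lambda>_. s)) (0\<^sub>m 1 n) (0\<^sub>m n 1) Y = 1\<^sub>m (Suc n)"
    if "X \<in> carrier_mat n n" "Y \<in> carrier_mat n n" "X * Y = 1\<^sub>m n" for X Y
    using that ss four_block_one_mat[of 1 n]
    by (subst mult_four_block_mat[of _ 1 1 _ n _ n _ _ 1 _ n]) auto
  show ?thesis
    using c one[OF c P'(2)] one[OF c(2,1) P'(3)] 
    by (intro GL_intro[of _ _ "four_block_mat (mat 1 1 (\<lambda>_. s)) (0\<^sub>m 1 n) (0\<^sub>m n 1) P'"]) auto
qed

text \<open>
  Among all matrices equivalent to \<open>A\<close>, take one whose corner entry \<open>a\<close> is nonzero and smallest in absolute value. Then \<open>a\<close> divides the rest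
  of its row and column, since otherwise one row or column operation and a swap would put a
  smaller nonzero remainder in the corner. This holds for \<^emph>\<open>every\<close> equivalent matrix with corner
  \<open>a\<close>. Hence the row and column can be cleared, and once they are, adding a lower row to the first
  one shows that \<open>a\<close> also divides the remaining block.
\<close>

lemma orbit_pivot:
  fixes A :: "int mat"
  assumes A: "A \<in> carrier_mat (Suc n) (Suc n)" and nz: "A \<noteq> 0\<^sub>m (Suc n) (Suc n)"
  obtains a M where "a \<noteq> 0" "M \<in> carrier_mat n n"
    "\<And>i j. i < n \<Longrightarrow> j < n \<Longrightarrow> a dvd M $$ (i, j)"
    "four_block_mat (mat 1 1 (\<lambda>_. a)) (0\<^sub>m 1 n) (0\<^sub>m n 1) M \<in> unimodular_orbit (Suc n) A"
proof -
  let ?O = "unimodular_orbit (Suc n) A"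
  note el = orbit_elementary[OF A]
  have dims: "dim_row B = Suc n" "dim_col B = Suc n" if "B \<in> ?O" for B
    using orbit_carrier[OF A that] by auto
  obtain i j where ij: "i < Suc n" "j < Suc n" "A $$ (i, j) \<noteq> 0"
    using nz A by (metis eq_matI carrier_matD index_zero_mat)
  have "swapcols 0 j (swaprows 0 i A) \<in> ?O" using el ij orbit_self[OF A] by simp
  moreover have "swapcols 0 j (swaprows 0 i A) $$ (0, 0) \<noteq> 0" using ij A by simp
  ultimately have ex: "\<exists>B. B \<in> ?O \<and> B $$ (0, 0) \<noteq> 0" by blast
  obtain B where B: "B \<in> ?O" "B $$ (0, 0) \<noteq> 0"
    and least: "\<And>C. C \<in> ?O \<Longrightarrow> C $$ (0, 0) \<noteq> 0 \<Longrightarrow> nat \<bar>B $$ (0, 0)\<bar> \<le> nat \<bar>C $$ (0, 0)\<bar>"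
    using ex_has_least_nat[of "\<lambda>B. B \<in> ?O \<and> B $$ (0, 0) \<noteq> 0" _ "\<lambda>B. nat \<bar>B $$ (0, 0)\<bar>"] ex
    by blast
  define a where "a = B $$ (0, 0)"
  have a: "a \<noteq> 0" using B by (simp add: a_def)
  have small: "C $$ (0, 0) = 0" if "C \<in> ?O" "\<bar>C $$ (0, 0)\<bar> < \<bar>a\<bar>" for C
    using least[OF that(1)] that(2) unfolding a_def by linarith
  have col: "a dvd C $$ (i, 0)" if C: "C \<in> ?O" "C $$ (0, 0) = a" and i: "i < Suc n" for C i
  proof (cases "i = 0")
    case False
    let ?C = "swaprows 0 i (addrow (- (C $$ (i, 0) div a)) i 0 C)"
    have "?C $$ (0, 0) = C $$ (i, 0) mod a"
      using False C dims[OF C(1)] i by (simp add: minus_div_mult_eq_mod[symmetric])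
    moreover have "?C \<in> ?O" using el C False i by simp
    ultimately show ?thesis using small[of ?C] abs_mod_less[OF a, of "C $$ (i, 0)"]
      by (simp add: dvd_eq_mod_eq_0)
  qed (use C in simp)
  have row: "a dvd C $$ (0, j)" if C: "C \<in> ?O" "C $$ (0, 0) = a" and j: "j < Suc n" for C j
  proof (cases "j = 0")
    case False
    let ?C = "swapcols 0 j (addcol (- (C $$ (0, j) div a)) j 0 C)"
    have "?C $$ (0, 0) = C $$ (0, j) mod a"
      using False C dims[OF C(1)] j by (simp add: minus_div_mult_eq_mod[symmetric])
    moreover have "?C \<in> ?O" using el C False j by simp
    ultimately show ?thesis using small[of ?C] abs_mod_less[OF a, of "C $$ (0, j)"]
      by (simp add: dvd_eq_mod_eq_0)
  qed (use C in simp)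
  \<comment> \<open>The multipliers that clear the first column and row, stored as columns.\<close>
  define c where "c = mat n 1 (\<lambda>(i, j). - (B $$ (Suc i, 0) div a))"
  define r where "r = mat n 1 (\<lambda>(i, j). - (B $$ (0, Suc i) div a))"
  define Lo where "Lo = four_block_mat (1\<^sub>m 1) (0\<^sub>m 1 n) c (1\<^sub>m n)"
  define Ro where "Ro = transpose_mat (four_block_mat (1\<^sub>m 1) (0\<^sub>m 1 n) r (1\<^sub>m n))"
  have c: "c \<in> carrier_mat n 1" and r: "r \<in> carrier_mat n 1" by (auto simp: c_def r_def)
  have Lo: "Lo \<in> GL (Suc n)" and Ro: "Ro \<in> GL (Suc n)"
    using GL_four_block_lower[OF c] GL_transpose[OF GL_four_block_lower[OF r]]
    by (auto simp: Lo_def Ro_def)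
  define C where "C = Lo * B * Ro"
  have CO: "C \<in> ?O" unfolding C_def by (rule orbit_trans[OF A B(1) Lo Ro])
  define M0 where "M0 = mat n n (\<lambda>(i, j). B $$ (Suc i, Suc j))"
  define a1 where "a1 = mat 1 1 (\<lambda>_. a)"
  have Ro': "Ro = four_block_mat (1\<^sub>m 1) (transpose_mat r) (0\<^sub>m n 1) (1\<^sub>m n)"
    unfolding Ro_def using r by (subst transpose_four_block_mat[of _ 1 1 _ n _ n]) auto
  have B': "B = four_block_mat a1 (- (a1 * transpose_mat r)) (- (c * a1)) M0" (is "_ = ?B")
  proof (rule eq_matI)
    show "dim_row B = dim_row ?B" "dim_col B = dim_col ?B" using dims[OF B(1)]
      by (auto simp: a1_def M0_def)
    fix i j assume "i < dim_row ?B" "j < dim_col ?B"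
    then have ij: "i < Suc n" "j < Suc n" by (auto simp: a1_def M0_def)
    show "B $$ (i, j) = ?B $$ (i, j)"
      using ij row[OF B(1) a_def[symmetric], of j] col[OF B(1) a_def[symmetric], of i]
      by (cases i; cases j) (auto simp: a1_def M0_def r_def c_def a_def scalar_prod_def)
  qed
  define M where "M = - (c * (a1 * transpose_mat r)) + M0"
  have car: "a1 \<in> carrier_mat 1 1" "M0 \<in> carrier_mat n n" "transpose_mat r \<in> carrier_mat 1 n"
    using r by (auto simp: a1_def M0_def)
  have Mc: "M \<in> carrier_mat n n" using car c by (auto simp: M_def)
  have "c * a1 + - (c * a1) = 0\<^sub>m n 1" "c * - (a1 * transpose_mat r) = - (c * (a1 * transpose_mat r))"
    using car c by auto
  then have LB: "Lo * B = four_block_mat a1 (- (a1 * transpose_mat r)) (0\<^sub>m n 1) M"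
    unfolding Lo_def B' using car c
    by (subst mult_four_block_mat[of _ 1 1 _ n _ n _ _ 1 _ n]) (auto simp: M_def)
  have "a1 * transpose_mat r + - (a1 * transpose_mat r) = 0\<^sub>m 1 n"
    using car c by auto
  then have C': "C = four_block_mat a1 (0\<^sub>m 1 n) (0\<^sub>m n 1) M"
    unfolding C_def LB Ro' using car c Mc
    by (subst mult_four_block_mat[of _ 1 1 _ n _ n _ _ 1 _ n]) auto
  have "a dvd M $$ (i, j)" if ij: "i < n" "j < n" for i j
  proof -
    \<comment> \<open>The corner is unchanged because the first column of \<open>C\<close> is already zero below it.\<close>
    let ?C = "addrow 1 0 (Suc i) C"
    have "?C \<in> ?O" using el(3)[OF CO, of 0 "Suc i"] ij by simp
    moreover have "?C $$ (0, 0) = a" "?C $$ (0, Suc j) = M $$ (i, j)"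
      unfolding C' using ij Mc by (auto simp: a1_def)
    ultimately show ?thesis using row[of ?C "Suc j"] ij by simp
  qed
  then show thesis using that[of a M] a Mc CO C' by (simp add: a1_def)
qed

lemma smith_form_bordered:
  assumes D: "smith_form n D" and dvd: "\<And>i j. i < n \<Longrightarrow> j < n \<Longrightarrow> a dvd D $$ (i, j)"
  shows "smith_form (Suc n) (four_block_mat (mat 1 1 (\<lambda>_. \<bar>a\<bar>)) (0\<^sub>m 1 n) (0\<^sub>m n 1) D)"
    (is "smith_form _ ?B")
proof -
  have c: "D \<in> carrier_mat n n" using D by (simp add: smith_form_def)
  have diag: "?B $$ (i, i) = (case i of 0 \<Rightarrow> \<bar>a\<bar> | Suc k \<Rightarrow> D $$ (k, k))" if "i < Suc n" for i
    using c that by (cases i) auto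
  have "?B $$ (i, j) = 0" if "i < Suc n" "j < Suc n" "i \<noteq> j" for i j
    using that c D by (cases i; cases j) (auto simp: smith_form_def diagonal_mat_def)
  moreover have "0 \<le> ?B $$ (i, i)" if "i < Suc n" for i
    using that D unfolding diag[OF that] by (auto simp: smith_form_def split: nat.split)
  moreover have "?B $$ (i, i) dvd ?B $$ (Suc i, Suc i)" if "Suc i < Suc n" for i
    using that D dvd unfolding diag[OF that] diag[OF Suc_lessD[OF that]]
    by (auto simp: smith_form_def split: nat.split)
  moreover have "?B \<in> carrier_mat (Suc n) (Suc n)" using c by auto
  ultimately show ?thesis unfolding smith_form_def diagonal_mat_def by (metis carrier_matD)
qed

lemma smith_form_exists:
  "A \<in> carrier_mat n n \<Longrightarrow> \<exists>D \<in> unimodular_orbit n A. smith_form n D"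
proof (induction n arbitrary: A)
  case 0
  then show ?case using orbit_self[OF 0]
    by (intro bexI[of _ A]) (auto simp: smith_form_def diagonal_mat_def)
next
  case (Suc n)
  show ?case
  proof (cases "A = 0\<^sub>m (Suc n) (Suc n)")
    case True
    then show ?thesis using orbit_self[OF Suc.prems]
      by (intro bexI[of _ A]) (auto simp: smith_form_def diagonal_mat_def)
  next
    case False
    obtain a M where a: "a \<noteq> 0" and M: "M \<in> carrier_mat n n"
      and dvd: "\<And>i j. i < n \<Longrightarrow> j < n \<Longrightarrow> a dvd M $$ (i, j)"
      and orb: "four_block_mat (mat 1 1 (\<lambda>_. a)) (0\<^sub>m 1 n) (0\<^sub>m n 1) M \<in> unimodular_orbit (Suc n) A"
      using orbit_pivot[OF Suc.prems False] by blast
    obtain P Q where P: "P \<in> GL n" and Q: "Q \<in> GL n" and D: "smith_form n (P * M * Q)"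
      using Suc.IH[OF M] by (auto simp: unimodular_orbit_def)
    note c = GL_carrier[OF P] GL_carrier[OF Q] M
    let ?b = "\<lambda>s X. four_block_mat (mat 1 1 (\<lambda>_. s)) (0\<^sub>m 1 n) (0\<^sub>m n 1) X :: int mat"
    have mult: "?b s X * ?b t Y = ?b (s * t) (X * Y)" 
      if "X \<in> carrier_mat n n" "Y \<in> carrier_mat n n" for s t X Y
    proof -
      have "mat 1 1 (\<lambda>_. s) * mat 1 1 (\<lambda>_. t) = mat 1 1 (\<lambda>_. s * t)"
        by (intro eq_matI) (auto simp: scalar_prod_def)
      then show ?thesis
        using that by (subst mult_four_block_mat[of _ 1 1 _ n _ n _ _ 1 _ n]) auto
    qed
    \<comment> \<open>The sign makes the new invariant factor nonnegative.\<close>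
    have "?b (sgn a) P * ?b a M * ?b 1 Q \<in> unimodular_orbit (Suc n) A"
      using a by (intro orbit_trans[OF Suc.prems orb] GL_block_diag P Q) (auto simp: sgn_if)
    also have "?b (sgn a) P * ?b a M * ?b 1 Q = ?b \<bar>a\<bar> (P * M * Q)"
      using c by (simp only: mult mult_carrier_mat[OF c(1,3)] mult_1_left mult_1_right abs_sgn mult.commute)
    finally have 1: "?b \<bar>a\<bar> (P * M * Q) \<in> unimodular_orbit (Suc n) A" .
    have 2: "a dvd (P * M * Q) $$ (i, j)" if "i < n" "j < n" for i j
      by (rule dvd_mult_entries[OF c(3,1,2) dvd that])
    have "smith_form (Suc n) (?b \<bar>a\<bar> (P * M * Q))"
      by (rule smith_form_bordered[OF D 2])
    with 1 show ?thesis by blast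
  qed
qed

section \<open>Invariant factors of complementary matrices\<close>

definition minor2 :: "int mat \<Rightarrow> nat \<Rightarrow> nat \<Rightarrow> nat \<Rightarrow> nat \<Rightarrow> int" where
  "minor2 A i k j l = A $$ (i, j) * A $$ (k, l) - A $$ (i, l) * A $$ (k, j)"

text \<open>
  Primitivity is stated by common divisors rather than by a gcd, because the candidates arise as
  common divisors of the entries (or minors) of an equivalent matrix.
\<close>

definition primitive_entries :: "nat \<Rightarrow> int mat \<Rightarrow> bool" where
  "primitive_entries n A \<longleftrightarrow> (\<forall>a. (\<forall>i<n. \<forall>j<n. a dvd A $$ (i, j)) \<longrightarrow> a dvd 1)"

lemma primitive_entriesI: "i < n \<Longrightarrow> j < n \<Longrightarrow> A $$ (i, j) dvd 1 \<Longrightarrow> primitive_entries n A"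
  unfolding primitive_entries_def by (meson dvd_trans)

definition primitive_minors2 :: "nat \<Rightarrow> int mat \<Rightarrow> bool" where
  "primitive_minors2 n A \<longleftrightarrow>
    (\<forall>a. (\<forall>i<n. \<forall>k<n. \<forall>j<n. \<forall>l<n. a dvd minor2 A i k j l) \<longrightarrow> a dvd 1)"

text \<open>
  Modulo \<open>a\<close>, the matrix \<open>A\<close> has a single nonzero row, hence \<open>P * A * Q\<close> is congruent to an outer
  product \<open>p i * w j\<close>, all of whose two-rowed minors vanish. For a Smith form and \<open>r = 0\<close> this shows
  that the second invariant factor divides all two-rowed minors of the original matrix.
\<close>

lemma dvd_minor2_mult:
  fixes A P Q :: "int mat"
  assumes A: "A \<in> carrier_mat n n" and P: "P \<in> carrier_mat n n" and Q: "Q \<in> carrier_mat n n"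
    and r: "r < n"
    and dvd: "\<And>i j. i < n \<Longrightarrow> j < n \<Longrightarrow> i \<noteq> r \<Longrightarrow> a dvd A $$ (i, j)"
    and "i < n" "k < n" "j < n" "l < n"
  shows "a dvd minor2 (P * A * Q) i k j l"
proof -
  define M where "M = P * A * Q"
  define p where "p i = P $$ (i, r)" for i
  define w where "w j = (A * Q) $$ (r, j)" for j
  have M: "M = P * (A * Q)" using assms by (simp add: M_def)
  have "\<exists>u. M $$ (i, j) = p i * w j + a * u" if ij: "i < n" "j < n" for i j
  proof -
    have "a dvd (A * Q) $$ (t, j)" if "t < n" "t \<noteq> r" for t
      using A Q ij that dvd[of t] by (auto simp: scalar_prod_def intro!: dvd_sum)
    then have "a dvd (\<Sum>t\<in>{0..<n} - {r}. P $$ (i, t) * (A * Q) $$ (t, j))"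
      by (intro dvd_sum) auto
    moreover have "M $$ (i, j) = (\<Sum>t\<in>{0..<n}. P $$ (i, t) * (A * Q) $$ (t, j))"
      using A P Q ij unfolding M by (simp add: scalar_prod_def)
    then have "M $$ (i, j) = p i * w j + (\<Sum>t\<in>{0..<n} - {r}. P $$ (i, t) * (A * Q) $$ (t, j))"
      using r by (simp add: sum.remove[of _ r] p_def w_def)
    ultimately show ?thesis by (auto elim!: dvdE)
  qed
  then obtain u where u: "\<And>i j. i < n \<Longrightarrow> j < n \<Longrightarrow> M $$ (i, j) = p i * w j + a * u i j" by metis
  have "minor2 M i k j l = a * (p i * w j * u k l + u i j * p k * w l + a * u i j * u k l
      - p i * w l * u k j - u i l * p k * w j - a * u i l * u k j)"
    using assms by (simp add: minor2_def u algebra_simps)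
  then show ?thesis by (simp add: M_def)
qed

lemma smith_form_dvd:
  assumes "smith_form n D" "i \<le> j" "j < n"
  shows "D $$ (i, i) dvd D $$ (j, j)"
  using assms(2,3)
proof (induction j rule: dec_induct)
  case (step k)
  then show ?case using assms(1) unfolding smith_form_def by (meson Suc_lessD dvd_trans)
qed simp

lemma smith_form_off_diagonal:
  assumes "smith_form n D" "i < n" "j < n" "i \<noteq> j"
  shows "D $$ (i, j) = 0"
  using assms unfolding smith_form_def diagonal_mat_def by auto

lemma orbit_sym:
  assumes A: "A \<in> carrier_mat n n" and "D \<in> unimodular_orbit n A"
  shows "A \<in> unimodular_orbit n D"
proof -
  obtain P Q where D: "D = P * A * Q" and PQ: "P \<in> GL n" "Q \<in> GL n"
    using assms(2) by (auto simp: unimodular_orbit_def)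
  obtain P' where P': "P' \<in> GL n" "P * P' = 1\<^sub>m n" "P' * P = 1\<^sub>m n" using PQ(1) by (rule GL_inverse)
  obtain Q' where Q': "Q' \<in> GL n" "Q * Q' = 1\<^sub>m n" "Q' * Q = 1\<^sub>m n" using PQ(2) by (rule GL_inverse)
  note c = A PQ[THEN GL_carrier] P'(1)[THEN GL_carrier] Q'(1)[THEN GL_carrier]
  have "P' * D * Q' = (P' * P) * A * (Q * Q')"
    unfolding D using c by (simp add: assoc_mult_mat[of _ n n _ n _ n])
  then have "A = P' * D * Q'" using c P' Q' by simp
  then show ?thesis using P'(1) Q'(1) unfolding unimodular_orbit_def by blast
qed

text \<open>
  With \<open>D = P * A * Q\<close>, the matrix \<open>Y\<close> is \<open>B\<close> transformed by the inverses of \<open>Q\<close> and \<open>P\<close>, so that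
  \<open>D * Y\<close> is \<open>c\<close> times the identity. As far as the diagonal of \<open>D\<close> is nonzero, this forces the rows of
  \<open>Y\<close> to be diagonal with entries \<open>c / D $$ (i, i)\<close>, and the divisibility chain of \<open>D\<close> is reversed.
  Rows where \<open>D\<close> vanishes are unconstrained; they occur only when \<open>c = 0\<close>.
\<close>

lemma smith_form_complement:
  assumes A: "A \<in> carrier_mat n n" and B: "B \<in> carrier_mat n n" and AB: "A * B = c \<cdot>\<^sub>m 1\<^sub>m n"
    and D: "D \<in> unimodular_orbit n A" "smith_form n D" and r: "r < n"
  obtains Y y where "Y \<in> carrier_mat n n" "B \<in> unimodular_orbit n Y" "D $$ (r, r) * y = c"
    "\<And>i j. D $$ (r, r) \<noteq> 0 \<Longrightarrow> i \<le> r \<Longrightarrow> j < n \<Longrightarrow> y dvd Y $$ (i, j)"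
proof -
  obtain P Q where D': "D = P * A * Q" and PQ: "P \<in> GL n" "Q \<in> GL n"
    using D(1) by (auto simp: unimodular_orbit_def)
  obtain P' where P': "P' \<in> GL n" "P * P' = 1\<^sub>m n" "P' * P = 1\<^sub>m n" using PQ(1) by (rule GL_inverse)
  obtain Q' where Q': "Q' \<in> GL n" "Q * Q' = 1\<^sub>m n" "Q' * Q = 1\<^sub>m n" using PQ(2) by (rule GL_inverse)
  note car = A B PQ[THEN GL_carrier] P'(1)[THEN GL_carrier] Q'(1)[THEN GL_carrier]
  define Y where "Y = Q' * B * P'"
  have Y: "Y \<in> carrier_mat n n" unfolding Y_def using car by auto
  have Dc: "D \<in> carrier_mat n n" using D(2) by (simp add: smith_form_def)
  have "Y \<in> unimodular_orbit n B" using P'(1) Q'(1) unfolding Y_def unimodular_orbit_def by blast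
  then have BY: "B \<in> unimodular_orbit n Y" by (rule orbit_sym[OF B])
  have "D * Y = P * (A * ((Q * Q') * (B * P')))"
    unfolding D' Y_def using car by (simp add: assoc_mult_mat[of _ n n _ n _ n])
  also have "\<dots> = P * ((A * B) * P')"
    using car Q' by (simp add: assoc_mult_mat[of _ n n _ n _ n])
  also have "\<dots> = c \<cdot>\<^sub>m 1\<^sub>m n"
    unfolding AB using car P'
    by (simp add: mult_smult_assoc_mat[of _ n n _ n] mult_smult_distrib[of _ n n _ n])
  finally have DY: "D * Y = c \<cdot>\<^sub>m 1\<^sub>m n" .
  have entry: "D $$ (i, i) * Y $$ (i, j) = (if i = j then c else 0)" if ij: "i < n" "j < n" for i j
  proof -
    have "(D * Y) $$ (i, j) = (\<Sum>t\<in>{0..<n}. D $$ (i, t) * Y $$ (t, j))"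
      using Dc Y ij by (simp add: scalar_prod_def)
    also have "\<dots> = (\<Sum>t\<in>{0..<n}. if t = i then D $$ (i, i) * Y $$ (i, j) else 0)"
      using smith_form_off_diagonal[OF D(2)] ij by (intro sum.cong) auto
    also have "\<dots> = D $$ (i, i) * Y $$ (i, j)" using ij by simp
    finally show ?thesis using ij by (auto simp: DY)
  qed
  have "Y $$ (r, r) dvd Y $$ (i, j)" if nz_r: "D $$ (r, r) \<noteq> 0" and ij: "i \<le> r" "j < n" for i j
  proof -
    obtain k where k: "D $$ (r, r) = D $$ (i, i) * k"
      using smith_form_dvd[OF D(2) ij(1) r] by (rule dvdE)
    have nz: "D $$ (i, i) \<noteq> 0" using k nz_r by auto
    show ?thesis
    proof (cases "i = j")
      case True
      have "D $$ (i, i) * Y $$ (i, i) = D $$ (i, i) * (k * Y $$ (r, r))"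
        using entry[of i i] entry[of r r] ij r k True by (simp add: mult.assoc)
      then have "Y $$ (i, i) = k * Y $$ (r, r)" using nz by simp
      then show ?thesis using True by simp
    next
      case False
      then have "Y $$ (i, j) = 0" using entry[of i j] ij r nz by simp
      then show ?thesis by simp
    qed
  qed
  then show thesis using that[OF Y BY, of "Y $$ (r, r)"] entry[of r r] r by simp
qed

lemma orbit_dvd_entries:
  assumes "A \<in> carrier_mat n n" "B \<in> unimodular_orbit n A" "primitive_entries n B"
    and "\<And>i j. i < n \<Longrightarrow> j < n \<Longrightarrow> a dvd A $$ (i, j)"
  shows "a dvd 1"
proof -
  obtain P Q where "B = P * A * Q" "P \<in> GL n" "Q \<in> GL n" using assms(2) by (auto simp: unimodular_orbit_def)
  then show ?thesis
    using assms(3) dvd_mult_entries[OF assms(1) GL_carrier GL_carrier assms(4)]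
    unfolding primitive_entries_def by blast
qed

lemma orbit_dvd_minors2:
  assumes "A \<in> carrier_mat n n" "B \<in> unimodular_orbit n A" "primitive_minors2 n B"
    and "r < n" "\<And>i j. i < n \<Longrightarrow> j < n \<Longrightarrow> i \<noteq> r \<Longrightarrow> a dvd A $$ (i, j)"
  shows "a dvd 1"
proof -
  obtain P Q where "B = P * A * Q" "P \<in> GL n" "Q \<in> GL n" using assms(2) by (auto simp: unimodular_orbit_def)
  then show ?thesis
    using assms(3) dvd_minor2_mult[OF assms(1) GL_carrier GL_carrier assms(4,5)]
    unfolding primitive_minors2_def by blast
qed

text \<open>
  Since a Smith form exists, the one chosen in \<open>invariant_factors\<close> really is equivalent to \<open>A\<close>.
\<close>

lemma invariant_factors_smith_form:
  assumes A: "A \<in> carrier_mat n n"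
  obtains D where "D \<in> unimodular_orbit n A" "smith_form n D"
    "invariant_factors A = map (\<lambda>i. D $$ (i, i)) [0..<n]"
proof -
  have snf: "smith_normal_form A D \<longleftrightarrow> D \<in> unimodular_orbit n A \<and> smith_form n D" for D
  proof -
    have "(\<exists>P \<in> carrier_mat (dim_row A) (dim_row A). \<exists>Q \<in> carrier_mat (dim_col A) (dim_col A).
       invertible_mat P \<and> invertible_mat Q \<and> D = P * A * Q) \<longleftrightarrow> D \<in> unimodular_orbit n A"
      using carrier_matD[OF A] unfolding unimodular_orbit_def GL_iff_invertible
      by (simp del: assoc_mult_mat) blast
    then show ?thesis
      unfolding smith_normal_form_def smith_form_def using orbit_carrier[OF A, of D] by auto
  qed
  obtain D\<^sub>0 where "smith_normal_form A D\<^sub>0" using smith_form_exists[OF A] unfolding snf by blast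
  then have "smith_normal_form A (SOME D. smith_normal_form A D)" by (rule someI)
  then have D: "(SOME D. smith_normal_form A D) \<in> unimodular_orbit n A" "smith_form n (SOME D. smith_normal_form A D)"
    unfolding snf[of "SOME D. smith_normal_form A D"] by simp_all
  show thesis
    using that[OF D] orbit_carrier[OF A D(1)] by (simp add: invariant_factors_def diag_mat_def)
qed

text \<open>
  By \<open>smith_form_complement\<close>, if \<open>D $$ (r, r)\<close> is nonzero, it has a cofactor \<open>y\<close> in \<open>c\<close> that divides
  the first \<open>r + 1\<close> rows of a matrix equivalent to \<open>B\<close>. If primitivity of \<open>B\<close> makes every such \<open>y\<close> a unit, then \<open>D $$ (r, r)\<close> is an
  associate of \<open>c\<close>, and all later factors are squeezed between \<open>D $$ (r, r)\<close> and \<open>c\<close> in the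
  divisibility order. If \<open>D $$ (r, r) = 0\<close>, then \<open>c\<close> and all later factors vanish as well.
\<close>

lemma smith_form_complement_eq:
  assumes A: "A \<in> carrier_mat n n" and B: "B \<in> carrier_mat n n" and AB: "A * B = c \<cdot>\<^sub>m 1\<^sub>m n"
    and c: "0 \<le> c" and D: "D \<in> unimodular_orbit n A" "smith_form n D" and r: "r < n"
    and unit: "\<And>Y y. \<lbrakk>Y \<in> carrier_mat n n; B \<in> unimodular_orbit n Y;
      \<And>i j. \<lbrakk>i \<le> r; j < n\<rbrakk> \<Longrightarrow> y dvd Y $$ (i, j)\<rbrakk> \<Longrightarrow> y dvd 1"
    and i: "r \<le> i" "i < n"
  shows "D $$ (i, i) = c"
proof -
  have dvd_c: "D $$ (i, i) dvd c"
    using smith_form_complement[OF A B AB D i(2)] by (metis dvd_triv_left)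
  show ?thesis
  proof (cases "D $$ (r, r) = 0")
    case True
    then have "D $$ (i, i) = 0" using smith_form_dvd[OF D(2) i] by simp
    with dvd_c show ?thesis by simp
  next
    case False
    obtain Y y where Y: "Y \<in> carrier_mat n n" "B \<in> unimodular_orbit n Y" "D $$ (r, r) * y = c"
      "\<And>i j. D $$ (r, r) \<noteq> 0 \<Longrightarrow> i \<le> r \<Longrightarrow> j < n \<Longrightarrow> y dvd Y $$ (i, j)"
      by (rule smith_form_complement[OF A B AB D r]) blast
    have "y dvd 1" by (rule unit[OF Y(1,2) Y(4)[OF False]])
    then have "c dvd D $$ (r, r)"
      using mult_dvd_mono[OF dvd_refl, of y 1 "D $$ (r, r)"] Y(3) by simp
    then have "c dvd D $$ (i, i)" using smith_form_dvd[OF D(2) i] by (rule dvd_trans)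
    then show ?thesis using dvd_c c D(2) i(2) unfolding smith_form_def
      by (simp add: zdvd_antisym_nonneg)
  qed
qed

lemma invariant_factors_first:
  assumes A: "A \<in> carrier_mat n n" and n: "0 < n" and prim: "primitive_entries n A"
  shows "hd (invariant_factors A) = 1"
proof -
  obtain D where D: "D \<in> unimodular_orbit n A" "smith_form n D"
    and inv: "invariant_factors A = map (\<lambda>i. D $$ (i, i)) [0..<n]"
    using A by (rule invariant_factors_smith_form)
  have "D $$ (0, 0) dvd D $$ (i, j)" if "i < n" "j < n" for i j
    using smith_form_dvd[OF D(2), of 0 i] smith_form_off_diagonal[OF D(2) that] that
    by (cases "i = j") auto
  then have "D $$ (0, 0) dvd 1"
    by (rule orbit_dvd_entries[OF orbit_carrier[OF A D(1)] orbit_sym[OF A D(1)] prim])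
  moreover have "0 \<le> D $$ (0, 0)" using D(2) n by (simp add: smith_form_def)
  ultimately show ?thesis using n by (simp add: inv upt_conv_Cons)
qed

lemma invariant_factors_first_two:
  assumes A: "A \<in> carrier_mat n n" and n: "2 \<le> n" and prim: "primitive_minors2 n A"
  shows "take 2 (invariant_factors A) = [1, 1]"
proof -
  obtain D where D: "D \<in> unimodular_orbit n A" "smith_form n D"
    and inv: "invariant_factors A = map (\<lambda>i. D $$ (i, i)) [0..<n]"
    using A by (rule invariant_factors_smith_form)
  have "D $$ (1, 1) dvd D $$ (i, j)" if "i < n" "j < n" "i \<noteq> 0" for i j
    using smith_form_dvd[OF D(2), of 1 i] smith_form_off_diagonal[OF D(2) that(1,2)] that
    by (cases "i = j") auto
  then have d1: "D $$ (1, 1) dvd 1"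
    using n
    by (intro orbit_dvd_minors2[OF orbit_carrier[OF A D(1)] orbit_sym[OF A D(1)] prim, of 0]) auto
  then have "D $$ (0, 0) dvd 1"
    using n by (intro dvd_trans[OF smith_form_dvd[OF D(2), of 0 1] d1]) auto
  moreover have "0 \<le> D $$ (0, 0)" "0 \<le> D $$ (1, 1)" using D(2) n by (auto simp: smith_form_def)
  ultimately have "D $$ (0, 0) = 1" "D $$ (1, 1) = 1" using d1 by auto
  moreover have "take 2 [0..<n] = [0, 1]" using n by (simp add: take_upt numeral_2_eq_2)
  ultimately show ?thesis by (simp add: inv take_map)
qed

lemma invariant_factors_last:
  assumes A: "A \<in> carrier_mat n n" and B: "B \<in> carrier_mat n n" and AB: "A * B = c \<cdot>\<^sub>m 1\<^sub>m n"
    and c: "0 \<le> c" and n: "0 < n" and prim: "primitive_entries n B"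
  shows "last (invariant_factors A) = c"
proof -
  obtain D where D: "D \<in> unimodular_orbit n A" "smith_form n D"
    and inv: "invariant_factors A = map (\<lambda>i. D $$ (i, i)) [0..<n]"
    using A by (rule invariant_factors_smith_form)
  have "D $$ (n - 1, n - 1) = c"
  proof (rule smith_form_complement_eq[OF A B AB c D, of "n - 1"])
    fix Y and y :: int
    assume Y: "Y \<in> carrier_mat n n" "B \<in> unimodular_orbit n Y"
      "\<And>i j. \<lbrakk>i \<le> n - 1; j < n\<rbrakk> \<Longrightarrow> y dvd Y $$ (i, j)"
    show "y dvd 1" by (rule orbit_dvd_entries[OF Y(1,2) prim]) (use Y(3) in auto)
  qed (use n in auto)
  then show ?thesis using n by (simp add: inv last_map)
qed

lemma invariant_factors_last_two:
  assumes A: "A \<in> carrier_mat n n" and B: "B \<in> carrier_mat n n" and AB: "A * B = c \<cdot>\<^sub>m 1\<^sub>m n"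
    and c: "0 \<le> c" and n: "2 \<le> n" and prim: "primitive_minors2 n B"
  shows "drop (length (invariant_factors A) - 2) (invariant_factors A) = [c, c]"
proof -
  obtain D where D: "D \<in> unimodular_orbit n A" "smith_form n D"
    and inv: "invariant_factors A = map (\<lambda>i. D $$ (i, i)) [0..<n]"
    using A by (rule invariant_factors_smith_form)
  have "D $$ (i, i) = c" if i: "n - 2 \<le> i" "i < n" for i
  proof (rule smith_form_complement_eq[OF A B AB c D _ _ i])
    fix Y and y :: int
    assume Y: "Y \<in> carrier_mat n n" "B \<in> unimodular_orbit n Y"
      "\<And>i j. \<lbrakk>i \<le> n - 2; j < n\<rbrakk> \<Longrightarrow> y dvd Y $$ (i, j)"
    \<comment> \<open>The first \<open>n - 1\<close> rows are all rows but the last one.\<close>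
    show "y dvd 1"
      using n by (intro orbit_dvd_minors2[OF Y(1,2) prim, of "n - 1"] Y(3)) auto
  qed (use n in simp)
  moreover have "drop (n - 2) [0..<n] = [n - 2, n - 1]"
  proof -
    obtain k where "n = Suc (Suc k)" using n by (metis add_2_eq_Suc le_Suc_ex)
    then show ?thesis by (simp add: drop_upt)
  qed
  ultimately show ?thesis using n by (simp add: inv drop_map)
qed

section \<open>The signed adjacency matrix of an Adinkra\<close>

text \<open>
  Two different edges of a 4-cycle that meet in \<open>f\<close> are neighbors on the cycle, so they can serve
  as its first two edges.
\<close>

lemma four_cycle_at_vertex:
  assumes Q: "four_cycle Q" and e: "{a, f} \<in> Q" "{b, f} \<in> Q" "a \<noteq> b"
  obtains g where "distinct [a, f, b, g]" "Q = {{a, f}, {f, b}, {b, g}, {g, a}}"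
proof -
  obtain p q r t where d: "distinct [p, q, r, t]" and Q: "Q = {{p, q}, {q, r}, {r, t}, {t, p}}"
    using Q by (auto simp: four_cycle_def)
  have f: "f \<in> {p, q, r, t}" using e(1) Q by auto
  \<comment> \<open>Rotate the cycle until \<open>f\<close> is its second vertex.\<close>
  obtain p q r t where d: "distinct [p, q, r, t]" and Q: "Q = {{p, q}, {q, r}, {r, t}, {t, p}}"
    and f: "f = q"
  proof -
    have rot: "{{p, q}, {q, r}, {r, t}, {t, p}} = {{q, r}, {r, t}, {t, p}, {p, q}}" for p q r t :: 'a
      by blast
    have "Q = {{q, r}, {r, t}, {t, p}, {p, q}}" "Q = {{r, t}, {t, p}, {p, q}, {q, r}}"
      "Q = {{t, p}, {p, q}, {q, r}, {r, t}}"
      using Q rot by metis+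
    then show thesis
      using f d that[of p q r t] that[of q r t p] that[of r t p q] that[of t p q r] Q by auto
  qed
  have "a \<noteq> f" "b \<noteq> f" using d e(1,2) unfolding Q f by (auto simp: doubleton_eq_iff)
  then have "a \<in> {p, r}" "b \<in> {p, r}" using d e(1,2) unfolding Q f by (auto simp: doubleton_eq_iff)
  then consider "a = p" "b = r" | "a = r" "b = p" using e(3) by auto
  then show thesis
  proof cases
    case 1
    then show thesis using that[of t] d f Q by auto
  next
    case 2
    have "{q, p} = {p, q}" "{r, q} = {q, r}" "{t, r} = {r, t}" "{p, t} = {t, p}" by auto
    then have "Q = {{r, q}, {q, p}, {p, t}, {t, r}}" unfolding Q by auto
    then show thesis using that[of t] d f 2 by auto
  qed
qed

lemma prod_signs:
  fixes \<mu> :: "'a \<Rightarrow> int"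
  assumes "finite Q" "\<And>e. e \<in> Q \<Longrightarrow> \<mu> e \<in> {-1, 1}"
  shows "prod \<mu> Q = (-1) ^ card {e \<in> Q. \<mu> e = -1}"
proof -
  have "prod \<mu> Q = (\<Prod>e\<in>Q. if \<mu> e = -1 then -1 else 1)"
    using assms(2) by (intro prod.cong) auto
  also have "\<dots> = (\<Prod>e\<in>{e \<in> Q. \<mu> e = -1}. -1)"
    using assms(1) by (simp add: prod.If_cases Int_def)
  finally show ?thesis by simp
qed

context adinkra
begin

definition signed_adjacency :: "'v \<Rightarrow> 'v \<Rightarrow> int" where
  "signed_adjacency v w = (if {v, w} \<in> E then \<mu> {v, w} else 0)"

lemma signed_adjacency_commute: "signed_adjacency v w = signed_adjacency w v"
  by (simp add: signed_adjacency_def insert_commute)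

lemma signed_adjacency_square: "{v, w} \<in> E \<Longrightarrow> signed_adjacency v w * signed_adjacency v w = 1"
  using signature[of "{v, w}"] by (auto simp: signed_adjacency_def)

lemma edge_distinct: "{v, w} \<in> E \<Longrightarrow> v \<noteq> w"
  using edges[of "{v, w}"] by auto

lemma edge_in_V: "{v, w} \<in> E \<Longrightarrow> v \<in> V \<and> w \<in> V"
  using edges[of "{v, w}"] by auto

lemma edge_bipartite: "{v, w} \<in> E \<Longrightarrow> v \<in> bosons \<longleftrightarrow> w \<in> fermions"
  using bipartite[of "{v, w}"] bipartition by (auto simp: doubleton_eq_iff)

lemma edge_determined_by_color:
  assumes "{v, w} \<in> E" "{v, w'} \<in> E" "color {v, w} = color {v, w'}"
  shows "w = w'"
proof -
  have "inj_on color {e \<in> E. v \<in> e}"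
    using one_edge_of_each_color edge_in_V[OF assms(1)] by (auto simp: bij_betw_def)
  then have "{v, w} = {v, w'}" using assms by (auto dest!: inj_onD)
  then show ?thesis by (auto simp: doubleton_eq_iff)
qed

lemma color_less: "{v, w} \<in> E \<Longrightarrow> color {v, w} < N"
  using one_edge_of_each_color[of v] edge_in_V[of v w] by (force simp: bij_betw_def)

lemma card_neighbors:
  assumes "v \<in> V" shows "card {w. {v, w} \<in> E} = N"
proof -
  have "bij_betw (\<lambda>w. {v, w}) {w. {v, w} \<in> E} {e \<in> E. v \<in> e}"
  proof (rule bij_betw_imageI)
    show "inj_on (\<lambda>w. {v, w}) {w. {v, w} \<in> E}"
      by (auto simp: inj_on_def doubleton_eq_iff)
    have "\<exists>w. e = {v, w}" if "e \<in> E" "v \<in> e" for e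
      using bipartite[OF that(1)] that(2) by auto
    then show "(\<lambda>w. {v, w}) ` {w. {v, w} \<in> E} = {e \<in> E. v \<in> e}" by auto
  qed
  then have "card {w. {v, w} \<in> E} = card {e \<in> E. v \<in> e}" by (rule bij_betw_same_card)
  also have "\<dots> = N" using bij_betw_same_card[OF one_edge_of_each_color[OF assms]] by simp
  finally show ?thesis .
qed

text \<open>
  Two edges \<open>a - f - b\<close> of different colors lie on one bicolor cycle, whose fourth vertex \<open>g\<close> is another
  common neighbor of \<open>a\<close> and \<open>b\<close>. The number of dashed edges is odd, so the two paths from \<open>a\<close> to \<open>b\<close>
  along the cycle have opposite signs. The colors along the second path are swapped, which makes
  \<open>f\<close> in turn the vertex opposite to \<open>g\<close>.
\<close>

lemma opposite_vertex:
  assumes e: "{a, f} \<in> E" "{b, f} \<in> E" "a \<noteq> b"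
  obtains g where "{a, g} \<in> E" "{b, g} \<in> E"
    "color {b, g} = color {a, f}" "color {a, g} = color {b, f}"
    "signed_adjacency a g * signed_adjacency b g = - (signed_adjacency a f * signed_adjacency b f)"
proof -
  define i j where "i = color {a, f}" and "j = color {b, f}"
  have ij: "i < N" "j < N" "i \<noteq> j"
    using color_less e edge_determined_by_color[of f a b] by (auto simp: i_def j_def insert_commute)
  obtain QQ where QQ: "\<And>Q. Q \<in> QQ \<Longrightarrow> four_cycle Q"
    and disj: "pairwise (\<lambda>Q R. disjnt (\<Union>Q) (\<Union>R)) QQ"
    and un: "\<Union>QQ = bicolor_edges E color i j"
    using bicolor_four_cycles[OF ij] by (auto simp: disjoint_union_of_four_cycles_def)
  have "{a, f} \<in> \<Union>QQ" "{b, f} \<in> \<Union>QQ"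
    using e unfolding un by (auto simp: bicolor_edges_def i_def j_def)
  then obtain Q R where Q: "Q \<in> QQ" "{a, f} \<in> Q" and R: "R \<in> QQ" "{b, f} \<in> R" by blast
  have "\<not> disjnt (\<Union>Q) (\<Union>R)" using Q R by (auto simp: disjnt_def)
  then have "R = Q" using disj Q R by (auto simp: pairwise_def)
  with R have "{b, f} \<in> Q" by simp
  then obtain g where d: "distinct [a, f, b, g]" and Q_eq: "Q = {{a, f}, {f, b}, {b, g}, {g, a}}"
    using four_cycle_at_vertex[OF QQ[OF Q(1)] Q(2) _ e(3)] by blast
  have sub: "Q \<subseteq> bicolor_edges E color i j" using Q(1) un by blast
  then have g: "{a, g} \<in> E" "{b, g} \<in> E" "color {a, g} \<in> {i, j}" "color {b, g} \<in> {i, j}"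
    unfolding Q_eq by (auto simp: bicolor_edges_def insert_commute)
  have "color {b, g} \<noteq> j" "color {a, g} \<noteq> i"
    using edge_determined_by_color[of b g f] edge_determined_by_color[of a g f] e g d
    by (auto simp: i_def j_def)
  then have col: "color {b, g} = i" "color {a, g} = j" using g by auto
  have "prod \<mu> Q = (-1) ^ card {e \<in> Q. \<mu> e = -1}"
    using sub signature by (intro prod_signs) (auto simp: Q_eq bicolor_edges_def)
  also have "\<dots> = -1" using odd_dashed[OF ij QQ[OF Q(1)] sub] by simp
  also have "prod \<mu> Q = \<mu> {a, f} * \<mu> {b, f} * (\<mu> {b, g} * \<mu> {a, g})"
    using d unfolding Q_eq by (auto simp: doubleton_eq_iff insert_commute)
  finally have "\<mu> {a, f} * \<mu> {b, f} * (\<mu> {b, g} * \<mu> {a, g}) = -1" .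
  then have "signed_adjacency a g * signed_adjacency b g
      = - (signed_adjacency a f * signed_adjacency b f)"
    using e g signature[OF e(1)] signature[OF e(2)] signature[OF g(1)] signature[OF g(2)]
    by (auto simp: signed_adjacency_def)
  then show thesis using that[of g] g col by (simp add: i_def j_def)
qed

text \<open>
  Passing to the opposite vertex is a sign-reversing involution on the common neighbors of
  \<open>a\<close> and \<open>b\<close>, so their contributions cancel.
\<close>

lemma signed_adjacency_orthogonal:
  assumes "a \<noteq> b"
  shows "(\<Sum>u\<in>V. signed_adjacency a u * signed_adjacency b u) = 0"
proof -
  let ?t = "\<lambda>u. signed_adjacency a u * signed_adjacency b u"
  define F where "F = {f. {a, f} \<in> E \<and> {b, f} \<in> E}"
  have "F \<subseteq> V" using edge_in_V by (auto simp: F_def)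
  have "\<exists>g. g \<in> F \<and> color {b, g} = color {a, f} \<and> color {a, g} = color {b, f} \<and> ?t g = - ?t f"
    if "f \<in> F" for f
    using that opposite_vertex[of a f b] assms unfolding F_def by blast
  then obtain opp where opp: "\<And>f. f \<in> F \<Longrightarrow> opp f \<in> F \<and> color {b, opp f} = color {a, f} \<and>
      color {a, opp f} = color {b, f} \<and> ?t (opp f) = - ?t f"
    by metis
  have inv: "opp (opp f) = f" if "f \<in> F" for f
  proof -
    have "color {b, opp (opp f)} = color {b, f}" "{b, opp (opp f)} \<in> E" "{b, f} \<in> E"
      using opp[OF that] opp[of "opp f"] that by (auto simp: F_def)
    then show ?thesis using edge_determined_by_color[of b "opp (opp f)" f] by simp
  qed
  have "sum ?t F = sum (\<lambda>f. - ?t f) F"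
    using opp inv by (intro sum.reindex_bij_witness[of F opp opp]) auto
  then have "sum ?t F = 0" by (simp add: sum_negf)
  moreover have "sum ?t V = sum ?t F"
    using finite_V \<open>F \<subseteq> V\<close>
    by (intro sum.mono_neutral_right) (auto simp: F_def signed_adjacency_def)
  ultimately show ?thesis by simp
qed

text \<open>
  The square of the signed adjacency matrix is \<open>N\<close> times the identity. The set \<open>W\<close> allows the sum to be
  restricted to the fermions when \<open>a\<close> is a boson, and conversely.
\<close>

lemma signed_adjacency_gram:
  assumes "a \<in> V" and W: "{u. {a, u} \<in> E} \<subseteq> W" "W \<subseteq> V"
  shows "(\<Sum>u\<in>W. signed_adjacency a u * signed_adjacency b u) = (if a = b then int N else 0)"
proof -
  let ?t = "\<lambda>b u. signed_adjacency a u * signed_adjacency b u"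
  have "sum (?t b) W = sum (?t b) V"
    using W finite_V by (intro sum.mono_neutral_left) (auto simp: signed_adjacency_def)
  moreover have "sum (?t a) V = int N"
  proof -
    have "sum (?t a) V = sum (?t a) {u. {a, u} \<in> E}"
      using W finite_V by (intro sum.mono_neutral_right) (auto simp: signed_adjacency_def)
    also have "\<dots> = sum (\<lambda>_. 1) {u. {a, u} \<in> E}"
      using signed_adjacency_square by (intro sum.cong) auto
    finally show ?thesis using card_neighbors[OF assms(1)] by simp
  qed
  ultimately show ?thesis using signed_adjacency_orthogonal[of a b] by auto
qed

lemma neighbor_exists:
  assumes "v \<in> V" obtains w where "{v, w} \<in> E"
proof -
  have "card {w. {v, w} \<in> E} \<noteq> 0" using card_neighbors[OF assms] N_pos by simp
  then have "{w. {v, w} \<in> E} \<noteq> {}" by (metis card.empty)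
  then show thesis using that by blast
qed

lemma edge_exists:
  obtains b f where "b \<in> bosons" "f \<in> fermions" "{b, f} \<in> E"
proof -
  obtain v where "v \<in> V" using V_nonempty by auto
  then obtain w where "{v, w} \<in> E" by (rule neighbor_exists)
  then show thesis using bipartite[of "{v, w}"] that by metis
qed

lemma boson_neighbors: "a \<in> bosons \<Longrightarrow> {u. {a, u} \<in> E} \<subseteq> fermions"
  using edge_bipartite by blast

lemma fermion_neighbors: "a \<in> fermions \<Longrightarrow> {u. {a, u} \<in> E} \<subseteq> bosons"
  using edge_bipartite by (auto simp: insert_commute)

lemma no_triangle: "{a, b} \<in> E \<Longrightarrow> {a, c} \<in> E \<Longrightarrow> {c, b} \<notin> E"
  using edge_bipartite bipartition edge_in_V by blast

text \<open>
  Counting the edges at the vertices of one class gives \<open>N\<close> times the size of that class.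
\<close>

lemma card_bosons_eq_card_fermions: "card bosons = card fermions"
proof -
  have sub: "bosons \<subseteq> V" "fermions \<subseteq> V" using bipartition by auto
  let ?s = "\<lambda>a b. signed_adjacency a b * signed_adjacency a b"
  have "(\<Sum>b\<in>bosons. \<Sum>f\<in>fermions. ?s b f) = (\<Sum>b\<in>bosons. int N)"
    using signed_adjacency_gram[OF _ boson_neighbors] sub by (intro sum.cong) auto
  moreover have "(\<Sum>f\<in>fermions. \<Sum>b\<in>bosons. ?s f b) = (\<Sum>f\<in>fermions. int N)"
    using signed_adjacency_gram[OF _ fermion_neighbors] sub by (intro sum.cong) auto
  moreover have "(\<Sum>b\<in>bosons. \<Sum>f\<in>fermions. ?s b f) = (\<Sum>f\<in>fermions. \<Sum>b\<in>bosons. ?s f b)"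
    by (subst sum.swap) (simp add: signed_adjacency_commute)
  ultimately show ?thesis using N_pos by simp
qed

end

lemma sum_nth_distinct:
  assumes "distinct xs"
  shows "(\<Sum>k\<in>{0..<length xs}. f (xs ! k)) = sum f (set xs)"
  using sum.reindex_bij_betw[OF bij_betw_nth[OF assms, of "{0..<length xs}" "set xs"]]
  by (simp add: atLeast0LessThan)

section \<open>The boson-fermion matrix and the Laplacian of an enumerated Adinkra\<close>

locale enumerated_adinkra = adinkra V E \<mu> bosons fermions N color h
  for V :: "'v set" and E :: "'v set set" and \<mu> :: "'v set \<Rightarrow> int"
    and bosons fermions :: "'v set" and N :: nat and color :: "'v set \<Rightarrow> nat" and h :: "'v \<Rightarrow> int" +
  fixes bs fs :: "'v list"
  assumes bs: "distinct bs" "set bs = bosons" and fs: "distinct fs" "set fs = fermions"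
begin

abbreviation bf_matrix :: "int mat" where "bf_matrix \<equiv> boson_fermion_matrix E \<mu> bs fs"

lemma length_fs: "length fs = length bs"
  using card_bosons_eq_card_fermions distinct_card[OF bs(1)] distinct_card[OF fs(1)] bs fs by simp

lemma bf_matrix_carrier: "bf_matrix \<in> carrier_mat (length bs) (length bs)"
  by (simp add: boson_fermion_matrix_def length_fs)

lemma bf_matrix_entry:
  "i < length bs \<Longrightarrow> j < length bs \<Longrightarrow> bf_matrix $$ (i, j) = signed_adjacency (bs ! i) (fs ! j)"
  by (simp add: boson_fermion_matrix_def signed_adjacency_def length_fs)

lemma bf_matrix_mult_transpose: "bf_matrix * transpose_mat bf_matrix = int N \<cdot>\<^sub>m 1\<^sub>m (length bs)"
proof (rule eq_matI)
  fix i j assume "i < dim_row (int N \<cdot>\<^sub>m 1\<^sub>m (length bs))" "j < dim_col (int N \<cdot>\<^sub>m 1\<^sub>m (length bs))"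
  then have ij: "i < length bs" "j < length bs" by auto
  have mem: "bs ! i \<in> bosons" using ij bs by auto
  have "(bf_matrix * transpose_mat bf_matrix) $$ (i, j) = (\<Sum>k\<in>{0..<length fs}. bf_matrix $$ (i, k) * bf_matrix $$ (j, k))"
    using ij bf_matrix_carrier by (simp add: scalar_prod_def length_fs)
  also have "\<dots> = (\<Sum>k\<in>{0..<length fs}.
      signed_adjacency (bs ! i) (fs ! k) * signed_adjacency (bs ! j) (fs ! k))"
    using ij bf_matrix_entry by (intro sum.cong) (auto simp: length_fs)
  also have "\<dots> = (\<Sum>u\<in>fermions. signed_adjacency (bs ! i) u * signed_adjacency (bs ! j) u)"
    using sum_nth_distinct[OF fs(1)] by (simp add: fs(2))
  also have "\<dots> = (if bs ! i = bs ! j then int N else 0)"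
    using mem bipartition by (intro signed_adjacency_gram boson_neighbors) auto
  finally show "(bf_matrix * transpose_mat bf_matrix) $$ (i, j) = (int N \<cdot>\<^sub>m 1\<^sub>m (length bs)) $$ (i, j)"
    using ij by (simp add: nth_eq_iff_index_eq[OF bs(1)])
qed (use bf_matrix_carrier in auto)

lemma bf_matrix_unit_entry:
  obtains i j where "i < length bs" "j < length bs" "bf_matrix $$ (i, j) dvd 1"
proof -
  obtain b f where "b \<in> bosons" "f \<in> fermions" and e: "{b, f} \<in> E" by (rule edge_exists)
  then obtain i j where ij: "i < length bs" "j < length bs" "b = bs ! i" "f = fs ! j"
    using bs fs length_fs by (metis in_set_conv_nth)
  have "bf_matrix $$ (i, j) dvd 1" using signed_adjacency_square[OF e] ij bf_matrix_entry by (metis dvd_triv_left)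
  then show thesis using that ij by blast
qed

abbreviation vs :: "'v list" where "vs \<equiv> bs @ fs"

lemma vs: "distinct vs" "set vs = V"
  using bs fs bipartition by auto

text \<open>
  With \<open>S\<close> the signed adjacency matrix in the order given by \<open>vs\<close>, this is \<open>N I + \<epsilon> S\<close>. The Laplacian
  is the case \<open>\<epsilon> = -1\<close>, and \<open>\<epsilon> = 1\<close> gives its complementary factor.
\<close>

definition shifted_adjacency :: "int \<Rightarrow> int mat" where
  "shifted_adjacency \<epsilon> = mat (length vs) (length vs)
    (\<lambda>(i, j). (if i = j then int N else 0) + \<epsilon> * signed_adjacency (vs ! i) (vs ! j))"

lemma shifted_adjacency_carrier: "shifted_adjacency \<epsilon> \<in> carrier_mat (length vs) (length vs)"
  by (simp add: shifted_adjacency_def)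

lemma signed_laplacian_eq: "signed_laplacian N bf_matrix = shifted_adjacency (-1)"
proof (rule eq_matI)
  fix i j assume "i < dim_row (shifted_adjacency (-1))" "j < dim_col (shifted_adjacency (-1))"
  then have ij: "i < length bs + length bs" "j < length bs + length bs"
    by (auto simp: shifted_adjacency_def length_fs)
  have [simp]: "signed_adjacency (bs ! i) (bs ! j) = 0" if "i < length bs" "j < length bs" for i j
    using edge_bipartite[of "bs ! i" "bs ! j"] bipartition bs that nth_mem[of i bs] nth_mem[of j bs]
    by (auto simp: signed_adjacency_def)
  have [simp]: "signed_adjacency (fs ! i) (fs ! j) = 0" if "i < length fs" "j < length fs" for i j
    using edge_bipartite[of "fs ! i" "fs ! j"] bipartition fs that nth_mem[of i fs] nth_mem[of j fs]
    by (auto simp: signed_adjacency_def)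
  show "signed_laplacian N bf_matrix $$ (i, j) = shifted_adjacency (-1) $$ (i, j)"
    using ij bf_matrix_carrier length_fs bf_matrix_entry signed_adjacency_commute
    by (auto simp: signed_laplacian_def shifted_adjacency_def nth_append)
qed (use bf_matrix_carrier in \<open>auto simp: signed_laplacian_def shifted_adjacency_def length_fs\<close>)

text \<open>
  \<open>(N I - S) (N I + S) = N\<^sup>2 I - S\<^sup>2\<close>, and \<open>S\<^sup>2 = N I\<close>.
\<close>

lemma laplacian_complement:
  "shifted_adjacency (-1) * shifted_adjacency 1 = (int N * (int N - 1)) \<cdot>\<^sub>m 1\<^sub>m (length vs)"
proof (rule eq_matI)
  let ?m = "length vs"
  fix i j assume "i < dim_row ((int N * (int N - 1)) \<cdot>\<^sub>m 1\<^sub>m ?m)" "j < dim_col ((int N * (int N - 1)) \<cdot>\<^sub>m 1\<^sub>m ?m)"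
  then have ij: "i < ?m" "j < ?m" by auto
  let ?s = "\<lambda>i j. signed_adjacency (vs ! i) (vs ! j)"
  have gram: "(\<Sum>k\<in>{0..<?m}. ?s i k * ?s k j) = (if i = j then int N else 0)"
  proof -
    have "(\<Sum>k\<in>{0..<?m}. ?s i k * ?s k j)
        = (\<Sum>u\<in>V. signed_adjacency (vs ! i) u * signed_adjacency (vs ! j) u)"
      using sum_nth_distinct[OF vs(1), of "\<lambda>u. signed_adjacency (vs ! i) u * signed_adjacency (vs ! j) u"]
      unfolding vs(2) by (simp add: signed_adjacency_commute[of _ "vs ! j"])
    also have "\<dots> = (if vs ! i = vs ! j then int N else 0)"
      using ij vs nth_mem[of i vs] edge_in_V by (intro signed_adjacency_gram) auto
    finally show ?thesis using ij by (simp only: nth_eq_iff_index_eq[OF vs(1)])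
  qed
  have "(shifted_adjacency (-1) * shifted_adjacency 1) $$ (i, j)
      = (\<Sum>k\<in>{0..<?m}. shifted_adjacency (-1) $$ (i, k) * shifted_adjacency 1 $$ (k, j))"
    using ij shifted_adjacency_carrier[of 1] shifted_adjacency_carrier[of "-1"]
    by (simp add: scalar_prod_def)
  also have "\<dots> = (\<Sum>k\<in>{0..<?m}.
      (if k = i then int N * ((if i = j then int N else 0) + ?s i j) else 0)
        - (if k = j then int N * ?s i j else 0) - ?s i k * ?s k j)"
    using ij by (intro sum.cong) (auto simp: shifted_adjacency_def algebra_simps)
  also have "\<dots> = int N * ((if i = j then int N else 0) + ?s i j) - int N * ?s i j
      - (if i = j then int N else 0)"
    using ij by (simp add: sum_subtractf gram del: length_append)
  finally show "(shifted_adjacency (-1) * shifted_adjacency 1) $$ (i, j)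
      = ((int N * (int N - 1)) \<cdot>\<^sub>m 1\<^sub>m ?m) $$ (i, j)"
    using ij by (cases "i = j") (simp_all add: algebra_simps)
qed (auto simp: shifted_adjacency_def)

text \<open>
  Let \<open>i\<close> and \<open>j\<close> be adjacent and \<open>k\<close> any third vertex. The principal minor on \<open>i, j\<close> is \<open>N\<^sup>2 - 1\<close>.
  The minor with rows \<open>i, k\<close> and columns \<open>j, k\<close> is \<open>\<plusminus>N\<close>, because a path from \<open>i\<close> to \<open>j\<close> through \<open>k\<close>
  would close a triangle in a bipartite graph. These two minors are coprime.
\<close>

lemma primitive_minors2_shifted_adjacency:
  assumes \<epsilon>: "\<epsilon> * \<epsilon> = 1" and three: "2 < length vs"
  shows "primitive_minors2 (length vs) (shifted_adjacency \<epsilon>)"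
  unfolding primitive_minors2_def
proof (intro allI impI)
  let ?m = "length vs" and ?s = "\<lambda>i j. signed_adjacency (vs ! i) (vs ! j)"
  fix a :: int
  assume a: "\<forall>i<?m. \<forall>k<?m. \<forall>j<?m. \<forall>l<?m. a dvd minor2 (shifted_adjacency \<epsilon>) i k j l"
  obtain v w where e: "{v, w} \<in> E" by (rule edge_exists)
  then obtain i j where ij: "i < ?m" "j < ?m" "v = vs ! i" "w = vs ! j"
    using edge_in_V vs(2) by (metis in_set_conv_nth)
  have neq: "i \<noteq> j" using edge_distinct[OF e] ij by auto
  have "\<not> {0..<?m} \<subseteq> {i, j}" using card_mono[of "{i, j}" "{0..<?m}"] three neq by auto
  then obtain k where "k \<in> {0..<?m}" "k \<notin> {i, j}" by blast
  then have k: "k < ?m" "k \<noteq> i" "k \<noteq> j" by auto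
  have sq: "?s i j * ?s i j = 1" using signed_adjacency_square[OF e] ij by simp
  have loop: "?s l l = 0" for l using edge_distinct[of "vs ! l" "vs ! l"] by (auto simp: signed_adjacency_def)
  have tri: "?s i k * ?s k j = 0"
    using no_triangle[of "vs ! i" "vs ! j" "vs ! k"] e ij by (auto simp: signed_adjacency_def)
  have entry: "shifted_adjacency \<epsilon> $$ (p, q) = (if p = q then int N else \<epsilon> * ?s p q)"
    if "p < ?m" "q < ?m" for p q
    using that loop by (auto simp: shifted_adjacency_def)
  have "minor2 (shifted_adjacency \<epsilon>) i j i j = int N * int N - (\<epsilon> * \<epsilon>) * (?s i j * ?s i j)"
    using ij k neq by (simp add: minor2_def entry signed_adjacency_commute[of "vs ! j"])
  then have 1: "a dvd int N * int N - 1" using a ij k \<epsilon> sq by (metis mult_1)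
  have "minor2 (shifted_adjacency \<epsilon>) i k j k = \<epsilon> * ?s i j * int N - \<epsilon> * \<epsilon> * (?s i k * ?s k j)"
    using ij k neq by (simp add: minor2_def entry)
  then have "a dvd \<epsilon> * ?s i j * int N" using a ij k tri by (metis diff_zero mult_zero_right)
  then have "a dvd (\<epsilon> * ?s i j) * (\<epsilon> * ?s i j * int N)" by (rule dvd_mult)
  also have "(\<epsilon> * ?s i j) * (\<epsilon> * ?s i j * int N) = (\<epsilon> * \<epsilon>) * (?s i j * ?s i j) * int N"
    by (simp only: ac_simps)
  finally have "a dvd int N * int N" using \<epsilon> sq by simp
  with 1 have "a dvd int N * int N - (int N * int N - 1)" by (rule dvd_diff[rotated])
  then show "a dvd 1" by simp
qed

end

theorem theorem16:
  fixes V :: "'v set" and E :: "'v set set" and \<mu> :: "'v set \<Rightarrow> int"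
    and bosons fermions :: "'v set" and N :: nat
    and color :: "'v set \<Rightarrow> nat" and h :: "'v \<Rightarrow> int"
    and bs fs :: "'v list" and X L :: "int mat"
  assumes "adinkra V E \<mu> bosons fermions N color h"
    and "distinct bs" and "set bs = bosons"
    and "distinct fs" and "set fs = fermions"
    and "X = boson_fermion_matrix E \<mu> bs fs"
    and "L = signed_laplacian N X"
  shows "(hd (invariant_factors X) = 1 \<and> last (invariant_factors X) = int N) \<and>
    (2 < card V \<longrightarrow>
      take 2 (invariant_factors L) = [1, 1] \<and>
      drop (length (invariant_factors L) - 2) (invariant_factors L)
        = [int N * (int N - 1), int N * (int N - 1)])"
proof -
  interpret enumerated_adinkra V E \<mu> bosons fermions N color h bs fs
    using assms(1-5) by (intro enumerated_adinkra.intro enumerated_adinkra_axioms.intro) auto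
  obtain i j where ij: "i < length bs" "j < length bs"
    and unit: "boson_fermion_matrix E \<mu> bs fs $$ (i, j) dvd 1"
    by (rule bf_matrix_unit_entry)
  have prim: "primitive_entries (length bs) X" "primitive_entries (length bs) (transpose_mat X)"
    using primitive_entriesI[OF ij unit] primitive_entriesI[OF ij(2,1), of "transpose_mat X"]
      unit ij bf_matrix_carrier by (auto simp: assms(6))
  have X: "X \<in> carrier_mat (length bs) (length bs)"
    "X * transpose_mat X = int N \<cdot>\<^sub>m 1\<^sub>m (length bs)"
    using bf_matrix_carrier bf_matrix_mult_transpose by (auto simp: assms(6))
  have n: "0 < length bs" using ij(1) by linarith
  have L: "L = shifted_adjacency (-1)" by (simp add: assms(6,7) signed_laplacian_eq)
  have m: "length vs = card V" using vs distinct_card by metis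
  have "0 \<le> int N * (int N - 1)" using N_pos by simp
  then show ?thesis
    using invariant_factors_first[OF X(1) n prim(1)]
      invariant_factors_last[OF X(1) _ X(2) _ n prim(2)] X(1)
      invariant_factors_first_two[OF shifted_adjacency_carrier _ primitive_minors2_shifted_adjacency]
      invariant_factors_last_two[OF shifted_adjacency_carrier shifted_adjacency_carrier
        laplacian_complement _ _ primitive_minors2_shifted_adjacency]
    unfolding L m by simp
qed

end
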